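(* Let $n\ge 2$ and $0\le m\le n$, and let $X=\{x_1,\dots,x_m\}$ be a sub-source of $m$ symbols of a source $A$ of $n$ symbols. Define $$\mathcal{R}^{(n)}_{\min}(X)=\min_{\{B\,\mid\, X\sqsubseteq B,\ |B|=n\}}\mathcal{R}_H(B).$$ Then $$\mathcal{R}^{(n)}_{\min}(X)=\min_{C\in\Phi^{(n)}}\Big\{\min_{\{B\,\mid\, X\sqsubseteq B,\ |B|=n\}}\mathcal{R}_C(B)\Big\},$$ where $\Phi^{(n)}$ is the set of all possible Huffman codes that can be generated by the Huffman algorithm for sources of $n$ symbols.
   Context: All logarithms are base $2$. A (discrete memoryless) source $A$ of $n=|A|\ge 2$ symbols is an alphabet $\{a_1,\dots,a_n\}$ with probabilities $\mathrm{p}(a_i)>0$, $\sum_i \mathrm{p}(a_i)=1$. For a code $C$ assigning to $a_i$ a codeword of length $\mathrm{l}_C(a_i)$, the redundancy is $\mathcal{R}_C(A)=\sum_{i}\mathrm{p}(a_i)\,\mathrm{l}_C(a_i)+\sum_i \mathrm{p}(a_i)\log \mathrm{p}(a_i)$. A sub-source $X$ of $A$, written $X\sqsubseteq A$, is a (possibly empty) subset of the symbols of $A$ together with their associated probabilities (which need not sum to $1$); $|X|$ is its number of symbols. In the minimizations, $B$ ranges over sources on a fixed alphabet of $n$ symbols containing the symbols of $X$, such that the symbols of $X$ have in $B$ their given probabilities; the other probabilities are free (positive, with total sum $1$). Huffman algorithm: starting from the symbols of the source, repeatedly replace two symbols $a,b$ such that no other current symbol has smaller probability than either of them by a merged symbol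 $[a,b]$ with $\mathrm{p}([a,b])=\mathrm{p}(a)+\mathrm{p}(b)$, until a single symbol remains. The resulting nested bracketing is a full binary tree whose leaves are the original symbols; it represents a binary prefix-free code $H$ (a Huffman code) in which the codeword length of a symbol is the depth of its leaf. $\mathcal{R}_H(B)$ denotes the redundancy of a Huffman code for $B$ (it does not depend on how ties are broken). $\Phi^{(n)}$ is the set of codes on the given $n$-symbol alphabet that the Huffman algorithm outputs for some choice of source probabilities on that alphabet. *)

theory Defs
  imports Complex_Main
begin

text \<open>
  A source is a finite partial map from symbols to probabilities. A sub-source of it is
  a restriction, i.e. a map below it with respect to \<^const>\<open>map_le\<close>.
\<close>

definition prob :: "('a \<rightharpoonup> real) \<Rightarrow> 'a \<Rightarrow> real" where
  "prob A a = the (A a)"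

definition source :: "('a \<rightharpoonup> real) \<Rightarrow> bool" where
  "source A \<longleftrightarrow>
     finite (dom A) \<and> card (dom A) \<ge> 2 \<and>
     (\<forall>a\<in>dom A. prob A a > 0) \<and> (\<Sum>a\<in>dom A. prob A a) = 1"

text \<open>The sources on the alphabet \<open>S\<close> that have \<open>X\<close> as a sub-source.\<close>

definition extensions :: "'a set \<Rightarrow> ('a \<rightharpoonup> real) \<Rightarrow> ('a \<rightharpoonup> real) set" where
  "extensions S X = {B. source B \<and> dom B = S \<and> X \<subseteq>\<^sub>m B}"

type_synonym 'a code = "'a \<rightharpoonup> bool list"

definition redundancy :: "'a code \<Rightarrow> ('a \<rightharpoonup> real) \<Rightarrow> real" where
  "redundancy C A =
     (\<Sum>a\<in>dom A. prob A a * real (length (the (C a)))) +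
     (\<Sum>a\<in>dom A. prob A a * log 2 (prob A a))"

datatype 'a bracketing = Sym 'a | Merge "'a bracketing" "'a bracketing"

primrec weight :: "('a \<rightharpoonup> real) \<Rightarrow> 'a bracketing \<Rightarrow> real" where
  "weight A (Sym a) = prob A a"
| "weight A (Merge s t) = weight A s + weight A t"

primrec code_of :: "'a bracketing \<Rightarrow> 'a code" where
  "code_of (Sym a) = [a \<mapsto> []]"
| "code_of (Merge s t) =
     (map_option (Cons False) \<circ> code_of s) ++ (map_option (Cons True) \<circ> code_of t)"

text \<open>
  The current symbols form a set: no two of them share an original symbol, so they are
  always distinct. The two merged symbols may be written in either order, and ties may
  be broken in any way.
\<close>

inductive huffman_step ::
  "('a \<rightharpoonup> real) \<Rightarrow> 'a bracketing set \<Rightarrow> 'a bracketing set \<Rightarrow> bool" for A where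
  "\<lbrakk>s \<in> F; t \<in> F; s \<noteq> t;
    \<forall>u\<in>F - {s, t}. \<not> weight A u < weight A s \<and> \<not> weight A u < weight A t\<rbrakk>
   \<Longrightarrow> huffman_step A F (insert (Merge s t) (F - {s, t}))"

definition huffman_codes :: "('a \<rightharpoonup> real) \<Rightarrow> 'a code set" where
  "huffman_codes A = {code_of t | t. (huffman_step A)\<^sup>*\<^sup>* (Sym ` dom A) {t}}"

definition huffman_redundancy :: "('a \<rightharpoonup> real) \<Rightarrow> real" where
  "huffman_redundancy A = redundancy (SOME C. C \<in> huffman_codes A) A"

text \<open>The set \<open>\<Phi>\<close>, for the alphabet \<open>S\<close>.\<close>

definition all_huffman_codes :: "'a set \<Rightarrow> 'a code set" where
  "all_huffman_codes S = {C. \<exists>A. source A \<and> dom A = S \<and> C \<in> huffman_codes A}"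

definition has_minimum :: "real set \<Rightarrow> bool" where
  "has_minimum R \<longleftrightarrow> (\<exists>r\<in>R. \<forall>s\<in>R. r \<le> s)"

text \<open>Meaningful only if \<^const>\<open>has_minimum\<close> holds; the sets in question are infinite
  in general, so \<^const>\<open>Min\<close> does not apply.\<close>

definition minimum :: "real set \<Rightarrow> real" where
  "minimum R = (LEAST r. r \<in> R)"

definition min_redundancy :: "'a set \<Rightarrow> ('a \<rightharpoonup> real) \<Rightarrow> real" where
  "min_redundancy S X = minimum (huffman_redundancy ` extensions S X)"

end

(* For a fixed code with lengths l, the redundancy is minimised by giving the free symbols
   probabilities proportional to 2 powr (- l), by Gibbs' inequality. Since there are finitely many
   Huffman codes on a fixed alphabet, and a Huffman code of a source has the least redundancy
   among all of them on this source, both sides are the minimum of one and the same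
   two-variable function, taken in either order.

   Huffman codes are optimal even among all length functions satisfying Kraft's inequality: any
   such function can be changed, without raising the mean length, so that the two symbols merged
   in a Huffman step get a common length k + 1, and giving their merger the length k preserves
   the Kraft sum. *)

theory Submission
  imports Defs
begin

section \<open>Minima\<close>

lemma minimum_eqI: "r \<in> R \<Longrightarrow> (\<And>s. s \<in> R \<Longrightarrow> r \<le> s) \<Longrightarrow> minimum R = r"
  unfolding minimum_def by (rule Least_equality)

lemma has_minimumI: "r \<in> R \<Longrightarrow> (\<And>s. s \<in> R \<Longrightarrow> r \<le> s) \<Longrightarrow> has_minimum R"
  unfolding has_minimum_def by blast

lemma minimum_in: "has_minimum R \<Longrightarrow> minimum R \<in> R"
  and minimum_le: "has_minimum R \<Longrightarrow> s \<in> R \<Longrightarrow> minimum R \<le> s"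
  unfolding has_minimum_def using minimum_eqI by metis+

lemma has_minimum_finite: "finite R \<Longrightarrow> R \<noteq> {} \<Longrightarrow> has_minimum R"
  by (rule has_minimumI[of "Min R"]) auto

section \<open>Lengths satisfying Kraft's inequality\<close>

text \<open>The type \<open>'b\<close> is left open because the lengths are attached both to symbols
  and to the trees of a forest.\<close>

definition kraft :: "'b set \<Rightarrow> ('b \<Rightarrow> nat) \<Rightarrow> bool" where
  "kraft F l \<longleftrightarrow> (\<Sum>x\<in>F. (1/2) ^ l x) \<le> (1::real)"

lemma sum_remove2:
  assumes "finite F" "a \<in> F" "b \<in> F" "a \<noteq> b"
  shows "sum f F = f a + f b + sum f (F - {a, b})"
proof -
  have "F = insert a (insert b (F - {a, b}))"
    using assms by auto
  then have "sum f F = sum f (insert a (insert b (F - {a, b})))"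
    by simp
  also have "\<dots> = f a + f b + sum f (F - {a, b})"
    using assms by (simp add: add.assoc)
  finally show ?thesis .
qed

text \<open>Swapping two lengths permutes the Kraft terms, and the heavier element ends up with the
  shorter length.\<close>

lemma kraft_exchange:
  fixes w :: "'b \<Rightarrow> real"
  assumes F: "finite F" "a \<in> F" "p \<in> F" "a \<noteq> p"
    and w: "w a \<le> w p" and l: "l a \<le> l p" and k: "kraft F l"
  defines "l' \<equiv> l(a := l p, p := l a)"
  shows "kraft F l'" and "(\<Sum>x\<in>F. w x * l' x) \<le> (\<Sum>x\<in>F. w x * l x)"
proof -
  have rest: "sum (\<lambda>x. g x (l' x)) (F - {a, p}) = sum (\<lambda>x. g x (l x)) (F - {a, p})"
    for g :: "'b \<Rightarrow> nat \<Rightarrow> real"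
    by (rule sum.cong) (auto simp: l'_def)
  show "kraft F l'"
    using k rest[of "\<lambda>_ n. (1/2) ^ n"] F
    by (simp add: kraft_def sum_remove2[OF F]) (simp add: l'_def)
  \<comment> \<open>This product is exactly the amount by which the swap lowers the weighted
    sum.\<close>
  have "0 \<le> (w p - w a) * (real (l p) - real (l a))"
    using w l by (intro mult_nonneg_nonneg) auto
  then have "w a * l' a + w p * l' p \<le> w a * l a + w p * l p"
    using F by (simp add: l'_def algebra_simps)
  then show "(\<Sum>x\<in>F. w x * l' x) \<le> (\<Sum>x\<in>F. w x * l x)"
    using rest[of "\<lambda>x n. w x * real n"] by (simp add: sum_remove2[OF F])
qed

text \<open>If \<open>p\<close> is the only symbol of maximal length \<open>L\<close>, then \<open>2 ^ L\<close> times the Kraft sum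
  is odd, so it is less than \<open>2 ^ L\<close>.\<close>

lemma kraft_shorten:
  assumes F: "finite F" "p \<in> F" "q \<in> F" "q \<noteq> p"
    and mx: "\<And>x. x \<in> F \<Longrightarrow> x \<noteq> p \<Longrightarrow> l x < l p" and k: "kraft F l"
  shows "kraft F (l(p := l p - 1))"
proof -
  define L where "L = l p"
  \<comment> \<open>The second element \<open>q\<close> has a smaller length, so
    \<open>L - 1\<close> is not truncated and \<open>2 ^ L\<close> is even.\<close>
  have L: "L > 0" using mx[of q] F by (simp add: L_def)
  define R where "R = (\<Sum>x\<in>F - {p}. 2 ^ (L - l x) :: nat)"
  have "even R"
    unfolding R_def
    using mx L_def by (intro dvd_sum) auto
  have scale: "(2::real) ^ L * (1/2) ^ l x = 2 ^ (L - l x)" if "x \<in> F" for x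
  proof -
    have "l x \<le> L" using mx[OF that] by (cases "x = p") (auto simp: L_def)
    then show ?thesis by (simp add: power_diff power_one_over)
  qed
  have R: "2 ^ L * (\<Sum>x\<in>F - {p}. (1/2) ^ l x) = real R"
    by (simp add: R_def sum_distrib_left scale)
  have sp: "(\<Sum>x\<in>F. (1/2) ^ l x) = (1/2) ^ L + (\<Sum>x\<in>F - {p}. (1/2) ^ l x :: real)"
    using F by (simp add: sum.remove L_def)
  have "2 ^ L * (\<Sum>x\<in>F. (1/2) ^ l x) \<le> (2::real) ^ L"
    using k by (simp add: kraft_def)
  then have "1 + real R \<le> 2 ^ L"
    by (simp only: sp distrib_left R) (simp add: power_one_over)
  then have "real (1 + R) \<le> real (2 ^ L)" by simp
  then have "1 + R \<le> 2 ^ L" by (simp only: of_nat_le_iff)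
  moreover have "even ((2::nat) ^ L)" using L by simp
  ultimately have "2 + R \<le> 2 ^ L"
    using \<open>even R\<close> by presburger
  then have "real (2 + R) \<le> real (2 ^ L)" by (simp only: of_nat_le_iff)
  then have le: "2 + real R \<le> 2 ^ L" by simp
  \<comment> \<open>Scaled by \<open>2 ^ L\<close>, the term of \<open>p\<close> grows from 1 to 2,
    and \<open>le\<close> leaves just enough room for that.\<close>
  have h: "2 ^ L * (1/2) ^ (L - 1) = (2::real)"
    using L by (cases L) (simp_all add: power_one_over)
  have "(\<Sum>x\<in>F. (1/2) ^ (l(p := l p - 1)) x) = (1/2) ^ (L - 1) + (\<Sum>x\<in>F - {p}. (1/2) ^ l x :: real)"
    using F by (simp add: sum.remove L_def)
  then have "2 ^ L * (\<Sum>x\<in>F. (1/2) ^ (l(p := l p - 1)) x) \<le> (2::real) ^ L * 1"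
    using le by (simp only: distrib_left R h mult_1_right)
  then show ?thesis
    unfolding kraft_def by (simp only: mult_le_cancel_left_pos zero_less_power zero_less_numeral)
qed

text \<open>As long as the greatest length occurs only once, \<open>kraft_shorten\<close> lowers it.
  The total length falls each time, so this ends, and nonnegative weights keep the weighted sum from
  growing.\<close>

lemma kraft_two_longest:
  fixes w :: "'b \<Rightarrow> real"
  assumes F: "finite F" "s \<in> F" "t \<in> F" "s \<noteq> t"
    and w: "\<And>x. x \<in> F \<Longrightarrow> 0 \<le> w x" and k: "kraft F l"
  shows "\<exists>l' p q. kraft F l' \<and> (\<Sum>x\<in>F. w x * l' x) \<le> (\<Sum>x\<in>F. w x * l x) \<and>
    p \<in> F \<and> q \<in> F \<and> p \<noteq> q \<and> l' q = l' p \<and> (\<forall>x\<in>F. l' x \<le> l' p)"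
  using k
proof (induction "sum l F" arbitrary: l rule: less_induct)
  case less
  have "Max (l ` F) \<in> l ` F" using F by (intro Max_in) auto
  then obtain p where p: "p \<in> F" "l p = Max (l ` F)" by auto
  then have mx: "l x \<le> l p" if "x \<in> F" for x using F that by simp
  show ?case
  proof (cases "\<exists>q\<in>F. q \<noteq> p \<and> l q = l p")
    case True
    then show ?thesis using p mx less.prems by (metis order_refl)
  next
    case False
    then have mx': "l x < l p" if "x \<in> F" "x \<noteq> p" for x
      using mx[OF that(1)] that by force
    obtain q where q: "q \<in> F" "q \<noteq> p" using F by metis
    let ?l = "l(p := l p - 1)"
    have "kraft F ?l"
      using kraft_shorten[OF F(1) p(1) q mx' less.prems] by blast
    moreover have "sum ?l F < sum l F"
      using F(1) p mx'[OF q] by (intro sum_strict_mono_ex1) auto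
    moreover have "(\<Sum>x\<in>F. w x * ?l x) \<le> (\<Sum>x\<in>F. w x * l x)"
      by (intro sum_mono mult_left_mono) (auto simp: w)
    ultimately show ?thesis
      using less.hyps[of ?l] by (meson order_trans)
  qed
qed

text \<open>Two exchanges carry the two greatest lengths over to the lightest elements
  \<open>s\<close> and \<open>t\<close>, as if these were siblings at the bottom of a tree.\<close>

lemma kraft_siblings:
  fixes w :: "'b \<Rightarrow> real"
  assumes F: "finite F" "s \<in> F" "t \<in> F" "s \<noteq> t"
    and w: "\<And>x. x \<in> F \<Longrightarrow> 0 \<le> w x"
    and least: "\<And>x. x \<in> F - {s, t} \<Longrightarrow> w s \<le> w x \<and> w t \<le> w x"
    and k: "kraft F l"
  obtains l' n where "kraft F l'" "(\<Sum>x\<in>F. w x * l' x) \<le> (\<Sum>x\<in>F. w x * l x)"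
    "l' s = Suc n" "l' t = Suc n"
proof -
  obtain l1 p q where 1: "kraft F l1" "(\<Sum>x\<in>F. w x * l1 x) \<le> (\<Sum>x\<in>F. w x * l x)"
    and pq: "p \<in> F" "q \<in> F" "p \<noteq> q" "l1 q = l1 p" "\<forall>x\<in>F. l1 x \<le> l1 p"
    using kraft_two_longest[of F s t w l] F w k by blast
  define L where "L = l1 p"
  \<comment> \<open>First \<open>s\<close> becomes longest, while another longest element
    \<open>q'\<close> is kept in reserve for \<open>t\<close>.\<close>
  obtain l2 q' where 2: "kraft F l2" "(\<Sum>x\<in>F. w x * l2 x) \<le> (\<Sum>x\<in>F. w x * l x)"
    and q': "l2 s = L" "q' \<in> F" "q' \<noteq> s" "l2 q' = L" "\<forall>x\<in>F. l2 x \<le> L"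
  proof (cases "l1 s = L")
    case True
    obtain q' where "q' \<in> F" "q' \<noteq> s" "l1 q' = L" using pq L_def by metis
    then show ?thesis using that[of l1 q'] 1 True pq by (auto simp: L_def)
  next
    case False
    \<comment> \<open>The partner \<open>p'\<close> must differ from \<open>t\<close>, since
      \<open>least\<close> does not compare \<open>s\<close> with \<open>t\<close>. The other
      longest element \<open>r\<close> survives the swap.\<close>
    obtain p' r where p': "p' \<in> F" "p' \<noteq> t" "l1 p' = L" "r \<in> F" "r \<noteq> p'" "l1 r = L"
      using pq L_def by metis
    then have ne: "p' \<noteq> s" "r \<noteq> s" using False by auto
    let ?l = "l1(s := l1 p', p' := l1 s)"
    have ws: "w s \<le> w p'" using least p' ne by auto
    have ls: "l1 s \<le> l1 p'" using pq p' F L_def by simp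
    have "kraft F ?l" "(\<Sum>x\<in>F. w x * ?l x) \<le> (\<Sum>x\<in>F. w x * l1 x)"
      using kraft_exchange[OF F(1,2) p'(1) ne(1)[symmetric] ws ls 1(1)] by auto
    then show ?thesis
      using that[of ?l r] 1 p' ne pq F by (auto simp: L_def)
  qed
  obtain l3 where 3: "kraft F l3" "(\<Sum>x\<in>F. w x * l3 x) \<le> (\<Sum>x\<in>F. w x * l x)"
    "l3 s = L" "l3 t = L"
  proof (cases "l2 t = L")
    case True
    then show ?thesis using that 2 q' by blast
  next
    case False
    then have ne: "t \<noteq> q'" using q' by auto
    let ?l = "l2(t := l2 q', q' := l2 t)"
    have wt: "w t \<le> w q'" using least q' ne by auto
    have lt: "l2 t \<le> l2 q'" using q' F by simp
    have "kraft F ?l" "(\<Sum>x\<in>F. w x * ?l x) \<le> (\<Sum>x\<in>F. w x * l2 x)"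
      using kraft_exchange[OF F(1,3) q'(2) ne wt lt 2(1)] by auto
    then show ?thesis
      using that[of ?l] 2 q' ne F by auto
  qed
  \<comment> \<open>Two lengths 0 would already give a Kraft sum of 2. A positive \<open>L\<close>
    leaves a length \<open>L - 1\<close> for the merged symbol.\<close>
  have "L \<noteq> 0"
  proof
    assume "L = 0"
    then have "(\<Sum>x\<in>F. (1/2) ^ l3 x) = 2 + (\<Sum>x\<in>F - {s, t}. (1/2) ^ l3 x :: real)"
      using 3 by (simp add: sum_remove2[OF F])
    moreover have "(\<Sum>x\<in>F - {s, t}. (1/2) ^ l3 x) \<ge> (0::real)"
      by (intro sum_nonneg) simp
    ultimately show False using 3(1) by (simp add: kraft_def)
  qed
  then show ?thesis using that 3 by (metis not0_implies_Suc)
qed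

section \<open>Codes of bracketings\<close>

text \<open>The datatype allows repeated symbols, for which \<open>code_of\<close> would overwrite
  codewords.\<close>

primrec distinct_syms :: "'a bracketing \<Rightarrow> bool" where
  "distinct_syms (Sym a) \<longleftrightarrow> True"
| "distinct_syms (Merge s t) \<longleftrightarrow>
     distinct_syms s \<and> distinct_syms t \<and> set_bracketing s \<inter> set_bracketing t = {}"

text \<open>The total weight of all inner nodes. Each leaf is counted once per proper ancestor, so
  this is the weighted path length, in a form that follows the merging.\<close>

primrec cost :: "('a \<rightharpoonup> real) \<Rightarrow> 'a bracketing \<Rightarrow> real" where
  "cost A (Sym a) = 0"
| "cost A (Merge s t) = cost A s + cost A t + weight A s + weight A t"

abbreviation codeword_length :: "'a code \<Rightarrow> 'a \<Rightarrow> nat" where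
  "codeword_length C a \<equiv> length (the (C a))"

lemma finite_set_bracketing [simp]: "finite (set_bracketing t)"
  by (induction t) auto

lemma set_bracketing_nonempty [simp]: "set_bracketing t \<noteq> {}"
  by (induction t) auto

lemma dom_code_of [simp]: "dom (code_of t) = set_bracketing t"
  by (induction t) (auto split: if_splits)

text \<open>The operator \<open>++\<close> prefers its right operand, so only the left case has to
  exclude the symbols of the other side.\<close>

lemma codeword_length_Merge1:
  "a \<in> set_bracketing s \<Longrightarrow> a \<notin> set_bracketing t \<Longrightarrow>
    codeword_length (code_of (Merge s t)) a = Suc (codeword_length (code_of s) a)"
  using domIff[of a "code_of s"] domIff[of a "code_of t"] by (auto simp: map_add_def)

lemma codeword_length_Merge2:
  "a \<in> set_bracketing t \<Longrightarrow>
    codeword_length (code_of (Merge s t)) a = Suc (codeword_length (code_of t) a)"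
  using domIff[of a "code_of t"] by (auto simp: map_add_def)

lemma weight_eq_sum:
  "distinct_syms t \<Longrightarrow> weight A t = (\<Sum>a\<in>set_bracketing t. prob A a)"
  by (induction t) (auto simp: sum.union_disjoint)

lemma cost_eq_sum:
  "distinct_syms t \<Longrightarrow>
    cost A t = (\<Sum>a\<in>set_bracketing t. prob A a * codeword_length (code_of t) a)"
proof (induction t)
  case (Merge s t)
  let ?g = "\<lambda>a. prob A a * codeword_length (code_of (Merge s t)) a"
  have disj: "set_bracketing s \<inter> set_bracketing t = {}" using Merge.prems by simp
  have "sum ?g (set_bracketing s) =
      (\<Sum>a\<in>set_bracketing s. prob A a * codeword_length (code_of s) a + prob A a)"
    using disj
    by (intro sum.cong) (auto simp: codeword_length_Merge1 disjoint_iff algebra_simps simp del: code_of.simps)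
  moreover have "sum ?g (set_bracketing t) =
      (\<Sum>a\<in>set_bracketing t. prob A a * codeword_length (code_of t) a + prob A a)"
    by (intro sum.cong) (auto simp: codeword_length_Merge2 algebra_simps simp del: code_of.simps)
  moreover have "sum ?g (set_bracketing (Merge s t)) =
      sum ?g (set_bracketing s) + sum ?g (set_bracketing t)"
    using disj by (simp add: sum.union_disjoint del: code_of.simps)
  ultimately show ?case
    using Merge by (simp add: sum.distrib weight_eq_sum del: code_of.simps)
qed simp

text \<open>Merging lengthens every codeword by one, so the new Kraft sum is the average of the two
  old ones.\<close>

lemma kraft_code_of:
  "distinct_syms t \<Longrightarrow> kraft (set_bracketing t) (codeword_length (code_of t))"
proof (induction t)
  case (Merge s t)
  let ?g = "\<lambda>a. (1/2) ^ codeword_length (code_of (Merge s t)) a :: real"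
  have disj: "set_bracketing s \<inter> set_bracketing t = {}" using Merge.prems by simp
  have "sum ?g (set_bracketing s) =
      (\<Sum>a\<in>set_bracketing s. 1/2 * (1/2) ^ codeword_length (code_of s) a)"
    using disj
    by (intro sum.cong) (auto simp: codeword_length_Merge1 disjoint_iff simp del: code_of.simps)
  moreover have "sum ?g (set_bracketing t) =
      (\<Sum>a\<in>set_bracketing t. 1/2 * (1/2) ^ codeword_length (code_of t) a)"
    by (intro sum.cong) (auto simp: codeword_length_Merge2 simp del: code_of.simps)
  moreover have "sum ?g (set_bracketing (Merge s t)) =
      sum ?g (set_bracketing s) + sum ?g (set_bracketing t)"
    using disj by (simp add: sum.union_disjoint del: code_of.simps)
  ultimately show ?case
    using Merge
    by (simp add: kraft_def sum_divide_distrib[symmetric] del: code_of.simps)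
qed (simp add: kraft_def)

text \<open>Each merging adds one to the depth and at least one leaf. The bound leaves only finitely
  many codes on a given alphabet.\<close>

lemma codeword_length_less_card:
  "distinct_syms t \<Longrightarrow> a \<in> set_bracketing t \<Longrightarrow>
    codeword_length (code_of t) a < card (set_bracketing t)"
proof (induction t)
  case (Merge s t)
  have disj: "set_bracketing s \<inter> set_bracketing t = {}" using Merge.prems by simp
  have c: "card (set_bracketing (Merge s t)) = card (set_bracketing s) + card (set_bracketing t)"
    using disj by (simp add: card_Un_disjoint)
  have pos: "card (set_bracketing s) > 0" "card (set_bracketing t) > 0"
    by (simp_all add: card_gt_0_iff)
  show ?case
  proof (cases "a \<in> set_bracketing t")
    case True
    then have "codeword_length (code_of t) a < card (set_bracketing t)" using Merge by simp
    then show ?thesis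
      unfolding codeword_length_Merge2[OF True] c using pos by linarith
  next
    case False
    then have a: "a \<in> set_bracketing s" using Merge.prems by simp
    then have "codeword_length (code_of s) a < card (set_bracketing s)" using Merge by simp
    then show ?thesis
      unfolding codeword_length_Merge1[OF a False] c using pos by linarith
  qed
qed simp

section \<open>The Huffman algorithm\<close>

text \<open>The invariant of the algorithm: the trees partition the alphabet
  \<open>S\<close>.\<close>

definition forest :: "'a set \<Rightarrow> 'a bracketing set \<Rightarrow> bool" where
  "forest S F \<longleftrightarrow> finite F \<and> (\<forall>s\<in>F. distinct_syms s) \<and>
     (\<forall>s\<in>F. \<forall>t\<in>F. s \<noteq> t \<longrightarrow> set_bracketing s \<inter> set_bracketing t = {}) \<and>
     (\<Union>s\<in>F. set_bracketing s) = S"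

lemma forest_Sym: "finite S \<Longrightarrow> forest S (Sym ` S)"
  by (auto simp: forest_def)

lemma forest_huffman_step:
  assumes "forest S F" "huffman_step A F F'"
  shows "forest S F'"
  using assms(2)
proof cases
  case (1 s t)
  have disj: "set_bracketing u \<inter> set_bracketing v = {}" if "u \<in> F" "v \<in> F" "u \<noteq> v" for u v
    using assms(1) that unfolding forest_def by blast
  have "(\<Union>u\<in>F'. set_bracketing u) = (\<Union>u\<in>F. set_bracketing u)"
    using 1 by auto
  moreover have "finite F'" "\<forall>u\<in>F'. distinct_syms u"
    using assms(1) 1 disj[of s t] by (auto simp: forest_def)
  moreover have "set_bracketing (Merge s t) \<inter> set_bracketing u = {}" if "u \<in> F - {s, t}" for u
    using that 1 disj[of s u] disj[of t u] by auto
  then have "set_bracketing u \<inter> set_bracketing v = {}" if "u \<in> F'" "v \<in> F'" "u \<noteq> v" for u v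
    using that disj 1(1) by (metis DiffD1 Int_commute insertE)
  ultimately show ?thesis
    using assms(1) unfolding forest_def by simp
qed

lemma forest_huffman_steps:
  "(huffman_step A)\<^sup>*\<^sup>* F F' \<Longrightarrow> forest S F \<Longrightarrow> forest S F'"
  by (induction rule: rtranclp_induct) (auto intro: forest_huffman_step)

text \<open>A merged tree shares symbols with its part \<open>s\<close>, so it cannot be in the
  forest beside \<open>s\<close>. Hence a Huffman step inserts a new element, and sums over the
  forest split.\<close>

lemma forest_fresh:
  assumes "forest S F" "s \<in> F"
  shows "Merge s t \<notin> F"
proof
  assume "Merge s t \<in> F"
  moreover have "s \<noteq> Merge s t" by (induction s arbitrary: t) auto
  ultimately have "set_bracketing s \<inter> set_bracketing (Merge s t) = {}"
    using assms unfolding forest_def by blast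
  then show False by (auto simp: Int_Un_distrib)
qed

text \<open>The right side is the cost of hanging each tree \<open>u\<close> of the forest at depth
  \<open>l u\<close>. Induction runs backwards from the final tree, where a root depth can only add
  to the cost.\<close>

lemma huffman_steps_optimal:
  assumes "(huffman_step A)\<^sup>*\<^sup>* F {t}" "forest S F" "\<And>a. a \<in> S \<Longrightarrow> 0 \<le> prob A a" "kraft F l"
  shows "cost A t \<le> (\<Sum>u\<in>F. cost A u + weight A u * l u)"
  using assms(1,2,4)
proof (induction arbitrary: l rule: converse_rtranclp_induct)
  case base
  have "weight A t \<ge> 0"
    using base assms(3) by (auto simp: forest_def weight_eq_sum intro!: sum_nonneg)
  then show ?case by simp
next
  case (step F F')
  have fin: "finite F" using step.prems by (simp add: forest_def)
  have w: "weight A u \<ge> 0" if "u \<in> F" for u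
    using that step.prems(1) assms(3) by (auto simp: forest_def weight_eq_sum intro!: sum_nonneg)
  from step.hyps(1) show ?case
  proof cases
    case (1 a b)
    have ab: "a \<in> F" "b \<in> F" "a \<noteq> b" using 1 by auto
    obtain l' n where l': "kraft F l'"
      "(\<Sum>x\<in>F. weight A x * l' x) \<le> (\<Sum>x\<in>F. weight A x * l x)"
      "l' a = Suc n" "l' b = Suc n"
    proof (rule kraft_siblings[where w = "weight A", OF fin ab])
      show "kraft F l" by fact
    qed (use 1 w in \<open>auto simp: not_less\<close>)
    let ?m = "Merge a b"
    \<comment> \<open>Two terms for length \<open>Suc n\<close> add up to one for length
      \<open>n\<close>, so the Kraft sum is unchanged.\<close>
    let ?l = "l'(?m := n)"
    have fresh: "?m \<notin> F" using forest_fresh[OF step.prems(1) ab(1)] .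
    have F': "F' = insert ?m (F - {a, b})" by fact
    have rest: "sum (\<lambda>x. g x (?l x)) (F - {a, b}) = sum (\<lambda>x. g x (l' x)) (F - {a, b})"
      for g :: "'a bracketing \<Rightarrow> nat \<Rightarrow> real"
      using fresh by (intro sum.cong) auto
    have F'_sum: "sum (\<lambda>x. g x (?l x)) F' = g ?m n + sum (\<lambda>x. g x (l' x)) (F - {a, b})"
      for g :: "'a bracketing \<Rightarrow> nat \<Rightarrow> real"
    proof -
      have "sum (\<lambda>x. g x (?l x)) F' = g ?m (?l ?m) + sum (\<lambda>x. g x (?l x)) (F - {a, b})"
        unfolding F' using fresh fin by (intro sum.insert) auto
      then show ?thesis by (simp only: rest[of g] fun_upd_same)
    qed
    have "kraft F' ?l"
      using l' F'_sum[of "\<lambda>_ n. (1/2) ^ n"] by (simp add: kraft_def sum_remove2[OF fin ab])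
    then have "cost A t \<le> (\<Sum>u\<in>F'. cost A u + weight A u * ?l u)"
      using step.IH forest_huffman_step[OF step.prems(1) step.hyps(1)] by blast
    \<comment> \<open>Moving up one level saves the weights of \<open>a\<close> and
      \<open>b\<close>, which is what \<open>cost\<close> charges for merging them.\<close>
    also have "\<dots> = (\<Sum>u\<in>F. cost A u + weight A u * l' u)"
      using F'_sum[of "\<lambda>u n. cost A u + weight A u * n"] l'
      by (simp add: sum_remove2[OF fin ab] algebra_simps)
    also have "\<dots> \<le> (\<Sum>u\<in>F. cost A u + weight A u * l u)"
      using l' by (simp add: sum.distrib)
    finally show ?thesis .
  qed
qed

text \<open>Merging a lightest tree with a lightest of the remaining ones is a legal step and
  shrinks the forest. This yields some complete run, hence a Huffman code.\<close>

lemma huffman_steps_terminate: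
  "finite F \<Longrightarrow> F \<noteq> {} \<Longrightarrow> \<exists>t. (huffman_step A)\<^sup>*\<^sup>* F {t}"
proof (induction "card F" arbitrary: F rule: less_induct)
  case less
  obtain s where s: "s \<in> F" "\<And>u. u \<in> F \<Longrightarrow> weight A s \<le> weight A u"
    using arg_min_if_finite[OF less.prems, of "weight A"] by (meson not_le)
  show ?case
  proof (cases "F = {s}")
    case True
    then show ?thesis by blast
  next
    case False
    then have F': "finite (F - {s})" "F - {s} \<noteq> {}" using less.prems s by auto
    obtain t where t: "t \<in> F - {s}" "\<And>u. u \<in> F - {s} \<Longrightarrow> weight A t \<le> weight A u"
      using arg_min_if_finite[OF F', of "weight A"] by (meson not_le)
    let ?G = "insert (Merge s t) (F - {s, t})"
    have "huffman_step A F ?G"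
      using s t by (intro huffman_step.intros) (auto simp: not_less)
    moreover have "card ?G < card F"
    proof -
      have "card {s, t} \<le> card F" using s t less.prems by (intro card_mono) auto
      moreover have "card (F - {s, t}) = card F - card {s, t}"
        using s t by (intro card_Diff_subset) auto
      moreover have "card ?G \<le> Suc (card (F - {s, t}))"
        using less.prems by (intro card_insert_le_m1) auto
      moreover have "card {s, t} = 2" using t by auto
      ultimately show ?thesis by linarith
    qed
    moreover have "finite ?G" "?G \<noteq> {}" using less.prems by auto
    ultimately show ?thesis
      using less.hyps[of ?G] by (meson converse_rtranclp_into_rtranclp)
  qed
qed

section \<open>Huffman codes of sources: existence, optimality and finiteness\<close>

lemma huffman_codesE:
  assumes "C \<in> huffman_codes A" "finite (dom A)"
  obtains t where "C = code_of t" "(huffman_step A)\<^sup>*\<^sup>* (Sym ` dom A) {t}"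
    "distinct_syms t" "set_bracketing t = dom A"
proof -
  obtain t where t: "C = code_of t" "(huffman_step A)\<^sup>*\<^sup>* (Sym ` dom A) {t}"
    using assms unfolding huffman_codes_def by blast
  then have "forest (dom A) {t}"
    using forest_huffman_steps forest_Sym assms(2) by blast
  then show ?thesis using that t by (simp add: forest_def)
qed

lemma huffman_codes_nonempty: "source A \<Longrightarrow> huffman_codes A \<noteq> {}"
  using huffman_steps_terminate[of "Sym ` dom A" A]
  unfolding huffman_codes_def source_def by fastforce

lemma huffman_code_optimal:
  assumes "source A" "C \<in> huffman_codes A" "kraft (dom A) l"
  shows "(\<Sum>a\<in>dom A. prob A a * codeword_length C a) \<le> (\<Sum>a\<in>dom A. prob A a * l a)"
proof -
  have fin: "finite (dom A)" using assms by (simp add: source_def)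
  obtain t where t: "C = code_of t" "(huffman_step A)\<^sup>*\<^sup>* (Sym ` dom A) {t}"
    "distinct_syms t" "set_bracketing t = dom A"
    using huffman_codesE[OF assms(2) fin] .
  have inj: "inj_on Sym (dom A)" by (simp add: inj_on_def)
  \<comment> \<open>Here \<open>THE\<close> inverts the constructor \<open>Sym\<close>, which
    transports the lengths to the initial forest of leaves.\<close>
  let ?l = "\<lambda>u. l (THE a. u = Sym a)"
  have "kraft (Sym ` dom A) ?l"
    using assms(3) by (simp add: kraft_def sum.reindex[OF inj])
  then have "cost A t \<le> (\<Sum>u\<in>Sym ` dom A. cost A u + weight A u * ?l u)"
    using assms(1)
    by (intro huffman_steps_optimal[OF t(2) forest_Sym[OF fin]])
       (auto simp: source_def less_imp_le)
  then show ?thesis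
    using t by (simp add: cost_eq_sum sum.reindex[OF inj])
qed

lemma all_huffman_codesD:
  assumes "C \<in> all_huffman_codes S"
  shows "dom C = S" "kraft S (codeword_length C)" "\<And>a. a \<in> S \<Longrightarrow> codeword_length C a < card S"
proof -
  obtain A where A: "source A" "dom A = S" "C \<in> huffman_codes A"
    using assms unfolding all_huffman_codes_def by blast
  then have "finite (dom A)" by (simp add: source_def)
  with A(3) obtain t where "C = code_of t" "distinct_syms t" "set_bracketing t = dom A"
    by (rule huffman_codesE)
  then show "dom C = S" "kraft S (codeword_length C)" "\<And>a. a \<in> S \<Longrightarrow> codeword_length C a < card S"
    using A kraft_code_of[of t] codeword_length_less_card[of t] by auto
qed

text \<open>Finiteness is what makes the outer minimum over codes exist, although the sources
  producing them can be infinitely many.\<close>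

lemma finite_all_huffman_codes:
  assumes "finite S"
  shows "finite (all_huffman_codes S)"
proof (rule finite_subset)
  let ?W = "{w :: bool list. set w \<subseteq> UNIV \<and> length w \<le> card S}"
  show "finite {C. dom C = S \<and> ran C \<subseteq> ?W}"
    using assms by (intro finite_set_of_finite_maps finite_lists_length_le) auto
  show "all_huffman_codes S \<subseteq> {C. dom C = S \<and> ran C \<subseteq> ?W}"
    using all_huffman_codesD by (fastforce simp: ran_def dom_def)
qed

lemma some_huffman_code:
  assumes "source B" "dom B = S"
  shows "\<exists>C\<in>all_huffman_codes S. huffman_redundancy B = redundancy C B"
proof -
  have "(SOME C. C \<in> huffman_codes B) \<in> huffman_codes B"
    using huffman_codes_nonempty[OF assms(1)] by (simp add: some_in_eq)
  then show ?thesis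
    using assms unfolding huffman_redundancy_def all_huffman_codes_def by blast
qed

text \<open>Both sides have the same entropy term, so only mean lengths compete. A code generated
  for another source takes part through its Kraft inequality.\<close>

lemma huffman_redundancy_le:
  assumes "source B" "dom B = S" "C \<in> all_huffman_codes S"
  shows "huffman_redundancy B \<le> redundancy C B"
  using huffman_code_optimal[OF assms(1) someI_ex[of "\<lambda>C. C \<in> huffman_codes B"]]
    huffman_codes_nonempty[OF assms(1)] all_huffman_codesD(2)[OF assms(3)] assms(2)
  unfolding huffman_redundancy_def redundancy_def by auto

section \<open>Minimising the redundancy of a fixed code\<close>

text \<open>Only the free symbols vary, and Gibbs' inequality settles their best distribution. The
  assumptions \<open>full\<close> and \<open>part\<close> say that the leftover mass vanishes
  exactly when no symbol is free.\<close>

lemma has_minimum_redundancy: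
  fixes X :: "'a \<rightharpoonup> real"
  assumes S: "finite S" "card S \<ge> 2" "dom X \<subseteq> S"
    and pos: "\<And>a. a \<in> dom X \<Longrightarrow> prob X a > 0"
    and full: "dom X = S \<Longrightarrow> (\<Sum>a\<in>dom X. prob X a) = 1"
    and part: "dom X \<noteq> S \<Longrightarrow> (\<Sum>a\<in>dom X. prob X a) < 1"
  shows "has_minimum (redundancy C ` extensions S X)"
proof -
  define U where "U = S - dom X"
  define l where "l = codeword_length C"
  define r where "r = 1 - (\<Sum>a\<in>dom X. prob X a)"
  define Z where "Z = (\<Sum>a\<in>U. (1/2) ^ l a :: real)"
  \<comment> \<open>The leftover mass \<open>r\<close> is shared out in proportion to
    \<open>2 powr (- l a)\<close>, with \<open>Z\<close> as the normalising constant.\<close>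
  define q where "q a = r / Z * (1/2) ^ l a" for a
  define B where "B a = (if a \<in> dom X then X a else if a \<in> U then Some (q a) else None)" for a
  have finU: "finite U" using S by (simp add: U_def)
  have SU: "S = dom X \<union> U" "dom X \<inter> U = {}" using S U_def by auto
  have finX: "finite (dom X)" using S finite_subset by blast
  have split: "sum f S = sum f (dom X) + sum f U" for f :: "'a \<Rightarrow> real"
    unfolding SU(1) using finX finU SU(2) by (rule sum.union_disjoint)
  have rZ: "r > 0" "Z > 0" if "U \<noteq> {}"
  proof -
    show "r > 0" using that part S by (auto simp: r_def U_def)
    show "Z > 0" unfolding Z_def using that finU by (intro sum_pos) auto
  qed
  have q_pos: "q a > 0" if "a \<in> U" for a
    unfolding q_def using rZ that by (intro mult_pos_pos divide_pos_pos) auto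
  have sum_q: "sum q U = r"
  proof (cases "U = {}")
    case True
    then show ?thesis using full S by (simp add: r_def U_def)
  next
    case False
    have "sum q U = r / Z * Z" by (simp add: q_def Z_def sum_distrib_left)
    then show ?thesis using rZ(2)[OF False] by simp
  qed
  have BX: "prob B a = prob X a" if "a \<in> dom X" for a
    using that by (simp add: prob_def B_def)
  have BU: "prob B a = q a" if "a \<in> U" for a
    using that SU(2) by (auto simp: prob_def B_def)
  have domB: "dom B = S" using SU by (auto simp: B_def dom_def split: if_splits)
  have "prob B a > 0" if "a \<in> S" for a
    using that SU(1) pos q_pos BX BU by (metis UnE)
  moreover have "sum (prob B) S = 1"
    using sum_q by (simp add: split BX BU r_def)
  ultimately have "source B"
    unfolding source_def domB using S by simp
  then have B: "B \<in> extensions S X"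
    using domB by (auto simp: extensions_def map_le_def B_def)
  \<comment> \<open>With this choice \<open>l a + log 2 (q a)\<close> is the same constant on all
    free symbols.\<close>
  define c where "c = log 2 (r / Z)"
  have log_q: "log 2 (q a) = c - l a" if "a \<in> U" for a
    using rZ that by (auto simp: q_def c_def log_mult log_nat_power log_divide)
  have red: "redundancy C D =
      (\<Sum>a\<in>dom X. prob X a * (l a + log 2 (prob X a))) + (\<Sum>a\<in>U. prob D a * (l a + log 2 (prob D a)))"
    if D: "D \<in> extensions S X" for D
  proof -
    have "prob D a = prob X a" if "a \<in> dom X" for a
      using D that by (auto simp: extensions_def map_le_def prob_def)
    moreover have "dom D = S" using D by (simp add: extensions_def)
    ultimately show ?thesis
      unfolding redundancy_def by (simp add: split sum.distrib distrib_left l_def)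
  qed
  have "redundancy C B \<le> redundancy C D" if D: "D \<in> extensions S X" for D
  proof -
    have src: "source D" and domD: "dom D = S" using D by (auto simp: extensions_def)
    have DX: "prob D a = prob X a" if "a \<in> dom X" for a
      using D that by (auto simp: extensions_def map_le_def prob_def)
    have sumD: "sum (prob D) U = r"
      using src DX by (simp add: source_def domD split r_def)
    have "(\<Sum>a\<in>U. prob B a * (l a + log 2 (prob B a))) = c * sum q U"
      by (simp add: BU log_q sum_distrib_left mult.commute)
    \<comment> \<open>The added difference is 0, as both sums equal \<open>r\<close>. It allows a
      comparison term by term.\<close>
    also have "\<dots> = c * sum (prob D) U + (sum (prob D) U - sum q U) / ln 2"
      by (simp add: sumD sum_q)
    also have "\<dots> = (\<Sum>a\<in>U. c * prob D a + (prob D a - q a) / ln 2)"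
      by (simp add: sum.distrib sum_distrib_left sum_subtractf[symmetric] sum_divide_distrib)
    also have "\<dots> \<le> (\<Sum>a\<in>U. prob D a * (l a + log 2 (prob D a)))"
    proof (rule sum_mono)
      fix a assume a: "a \<in> U"
      then have d: "prob D a > 0" using src domD by (auto simp: source_def U_def)
      have qa: "q a > 0" using q_pos[OF a] .
      \<comment> \<open>The tangent bound of the logarithm at 1 gives Gibbs' inequality for a single
        symbol.\<close>
      have "ln (q a / prob D a) \<le> q a / prob D a - 1"
        using d qa by (intro ln_le_minus_one) simp
      then have "prob D a * (ln (q a) - ln (prob D a)) \<le> prob D a * (q a / prob D a - 1)"
        using d qa by (intro mult_left_mono) (auto simp: ln_div)
      also have "\<dots> = q a - prob D a" using d by (simp add: field_simps)
      finally have "prob D a - q a \<le> prob D a * (ln (prob D a) - ln (q a))"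
        by (simp add: algebra_simps)
      then have "(prob D a - q a) / ln 2 \<le> prob D a * (ln (prob D a) - ln (q a)) / ln 2"
        by (intro divide_right_mono) simp_all
      also have "\<dots> = prob D a * (log 2 (prob D a) - log 2 (q a))"
        by (simp add: log_def field_simps)
      finally show "c * prob D a + (prob D a - q a) / ln 2 \<le> prob D a * (l a + log 2 (prob D a))"
        by (simp add: log_q[OF a] algebra_simps)
    qed
    finally show ?thesis by (simp add: red[OF B] red[OF D])
  qed
  then show ?thesis using B by (intro has_minimumI[of "redundancy C B"]) auto
qed

section \<open>Exchanging the minimum over sources with the minimum over codes\<close>

theorem theorem1:
  fixes A X :: "'a \<rightharpoonup> real" and S :: "'a set" and n m :: nat
  assumes "n \<ge> 2" and "m \<le> n"
    and "source A" and "card (dom A) = n"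
    and "X \<subseteq>\<^sub>m A" and "card (dom X) = m"
    and "finite S" and "card S = n" and "dom X \<subseteq> S"
  shows "has_minimum (huffman_redundancy ` extensions S X) \<and>
    (\<forall>C\<in>all_huffman_codes S. has_minimum (redundancy C ` extensions S X)) \<and>
    has_minimum ((\<lambda>C. minimum (redundancy C ` extensions S X)) ` all_huffman_codes S) \<and>
    min_redundancy S X =
      minimum ((\<lambda>C. minimum (redundancy C ` extensions S X)) ` all_huffman_codes S)"
proof -
  let ?E = "extensions S X"
  let ?f = "\<lambda>C. minimum (redundancy C ` ?E)"
  have A: "finite (dom A)" "\<And>a. a \<in> dom A \<Longrightarrow> prob A a > 0" "sum (prob A) (dom A) = 1"
    using assms(3) by (auto simp: source_def)
  have XA: "dom X \<subseteq> dom A" using assms(5) by (rule map_le_implies_dom_le)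
  have prob_X: "prob X a = prob A a" if "a \<in> dom X" for a
    using assms(5) that by (auto simp: map_le_def prob_def)
  have min1: "has_minimum (redundancy C ` ?E)" for C
  proof (rule has_minimum_redundancy)
    assume "dom X = S"
    \<comment> \<open>Both alphabets have \<open>n\<close> symbols, so if \<open>X\<close> fills
      \<open>S\<close> it also fills \<open>A\<close> and has total mass 1.\<close>
    then have "dom X = dom A" using A XA assms by (metis card_subset_eq)
    then show "(\<Sum>a\<in>dom X. prob X a) = 1" using A prob_X by simp
  next
    assume "dom X \<noteq> S"
    then have "dom X \<noteq> dom A" using assms by (metis card_subset_eq)
    \<comment> \<open>A symbol of \<open>A\<close> outside \<open>X\<close> has positive
      probability, so mass is left for the free symbols.\<close>
    then obtain b where b: "b \<in> dom A - dom X" using XA by blast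
    then have "(\<Sum>a\<in>dom X. prob A a) < (\<Sum>a\<in>dom A. prob A a)"
      using A XA by (intro sum_strict_mono2[of _ _ b]) (auto simp: less_imp_le)
    then show "(\<Sum>a\<in>dom X. prob X a) < 1" using A prob_X by simp
    next
    fix a assume "a \<in> dom X"
    then show "prob X a > 0" using A(2) XA prob_X by (metis subsetD)
  qed (use assms in auto)
  have srcE: "source B" "dom B = S" if "B \<in> ?E" for B
    using that by (auto simp: extensions_def)
  obtain B0 where "B0 \<in> ?E" using min1 unfolding has_minimum_def by blast
  then have "all_huffman_codes S \<noteq> {}" using some_huffman_code srcE by blast
  then have min2: "has_minimum (?f ` all_huffman_codes S)"
    using finite_all_huffman_codes assms by (intro has_minimum_finite) auto
  let ?M = "minimum (?f ` all_huffman_codes S)"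
  obtain C where C: "C \<in> all_huffman_codes S" "?f C = ?M"
    using minimum_in[OF min2] by auto
  \<comment> \<open>The best source for the best code: here the Huffman redundancy will be squeezed
    to \<open>?M\<close>.\<close>
  obtain B where B: "B \<in> ?E" "redundancy C B = ?M"
    using minimum_in[OF min1[of C]] C by auto
  have lower: "?M \<le> huffman_redundancy D" if D: "D \<in> ?E" for D
  proof -
    obtain C' where C': "C' \<in> all_huffman_codes S" "huffman_redundancy D = redundancy C' D"
      using some_huffman_code srcE[OF D] by blast
    have "?M \<le> ?f C'" using C' by (intro minimum_le[OF min2]) auto
    also have "\<dots> \<le> redundancy C' D" using D by (intro minimum_le[OF min1]) auto
    finally show ?thesis using C' by simp
  qed
  have "huffman_redundancy B \<le> ?M"
    using huffman_redundancy_le[OF srcE[OF B(1)] C(1)] B(2) by simp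
  then have "huffman_redundancy B = ?M" using lower[OF B(1)] by simp
  then have M: "?M \<in> huffman_redundancy ` ?E" using B(1) by (metis imageI)
  have "has_minimum (huffman_redundancy ` ?E)"
    using M lower by (intro has_minimumI[of ?M]) auto
  moreover have "min_redundancy S X = ?M"
    unfolding min_redundancy_def using M lower by (intro minimum_eqI) auto
  ultimately show ?thesis using min1 min2 by blast
qed

end
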